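(* Let $y,q$ be indeterminates. For every $n\ge 0$, \[ [z^n]\left(\cfrac{1}{1-\cfrac{\lambda_1 z}{1-\cfrac{\lambda_2 z}{1-\cfrac{\lambda_3 z}{1-\cdots}}}}\right) =\frac{1}{(1-q)^{2n}}\sum_{k=0}^{n}\left(\binom{2n}{n-k}-\binom{2n}{n-k-1}\right)q^{k(k+1)}\sum_{i=-k}^{k}y^{i}q^{-i^2}, \] where for $m\ge 1$ odd, $\lambda_m=\dfrac{(1+yq^m)(1+y^{-1}q^m)}{(1-q)^2}$, and for $m\ge 2$ even, $\lambda_m=\left(\dfrac{1-q^m}{1-q}\right)^2$.
   Context: The infinite continued fraction is understood as a formal power series in $z$ (its coefficients are limits of those of its finite truncations). $[z^n]F$ denotes the coefficient of $z^n$ in the power series $F$. Binomial coefficients $\binom{a}{b}$ with $b<0$ are $0$. *)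

theory Defs
  imports "HOL-Computational_Algebra.Computational_Algebra"
begin

text \<open>
  The two indeterminates live in \<open>k(q)(y) = k(q, y)\<close>, represented as the field of fractions of
  \<open>k[q][y]\<close> over an arbitrary field \<open>k\<close>: \<open>q\<close> is the variable of the inner polynomial ring and
  \<open>y\<close> that of the outer one.
\<close>

definition indet_q :: "'a::field poly poly fract" where
  "indet_q = to_fract [:[:0, 1:]:]"

definition indet_y :: "'a::field poly poly fract" where
  "indet_y = to_fract [:0, 1:]"

text \<open>
  \<open>cf_denom l m N\<close> is \<open>1 - l m z / (1 - l (m + 1) z / (\<dots> / (1 - l (m + N - 1) z)))\<close>, with
  \<open>N\<close> partial numerators.
\<close>

fun cf_denom :: "(nat \<Rightarrow> 'a::field) \<Rightarrow> nat \<Rightarrow> nat \<Rightarrow> 'a fps" where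
  "cf_denom l m 0 = 1"
| "cf_denom l m (Suc N) = 1 - fps_const (l m) * fps_X / cf_denom l (Suc m) N"

definition cf_trunc :: "(nat \<Rightarrow> 'a::field) \<Rightarrow> nat \<Rightarrow> 'a fps" where
  "cf_trunc l N = 1 / cf_denom l 1 N"

text \<open>
  The limit is taken in the library's metric on formal power series, in which a sequence
  converges iff every coefficient is eventually constant. The limit always exists, see
  \<open>cf_trunc_tendsto\<close> and \<open>cf_nth_eq_trunc\<close> below.
\<close>

definition cont_frac :: "(nat \<Rightarrow> 'a::field) \<Rightarrow> 'a fps" where
  "cont_frac l = lim (cf_trunc l)"

definition lam :: "'a::field \<Rightarrow> 'a \<Rightarrow> nat \<Rightarrow> 'a" where
  "lam y q m =
     (if odd m then (1 + y * q ^ m) * (1 + inverse y * q ^ m) / (1 - q)\<^sup>2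
      else ((1 - q ^ m) / (1 - q))\<^sup>2)"

text \<open>
  An integer lower argument is needed: with truncated subtraction \<open>n - k - 1\<close> would be \<open>0\<close>
  instead of \<open>-1\<close> for \<open>k = n\<close>.
\<close>

definition binom :: "nat \<Rightarrow> int \<Rightarrow> nat" where
  "binom a b = (if b < 0 then 0 else a choose nat b)"

lemma cf_denom_nth_0 [simp]: "fps_nth (cf_denom l m N) 0 = 1"
  by (induction N arbitrary: m) (simp_all add: fps_divide_unit)

lemma fps_inverse_nth_cong:
  fixes f g :: "'a::field fps"
  assumes "\<And>j. j \<le> n \<Longrightarrow> fps_nth f j = fps_nth g j"
  shows "fps_nth (inverse f) n = fps_nth (inverse g) n"
  using assms
proof (induction n rule: less_induct)
  case (less n)
  have IH: "fps_nth (inverse f) i = fps_nth (inverse g) i" if "i < n" for i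
    using less that by simp
  show ?case
  proof (cases n)
    case 0
    then show ?thesis using less.prems[of 0] by simp
  next
    case (Suc k)
    have "(\<Sum>i=1..n. fps_nth f i * fps_nth (inverse f) (n - i)) =
          (\<Sum>i=1..n. fps_nth g i * fps_nth (inverse g) (n - i))"
      using less.prems IH by (intro sum.cong refl arg_cong2[where f = "(*)"]) auto
    moreover have "fps_nth (inverse h) n =
        - inverse (fps_nth h 0) * (\<Sum>i=1..n. fps_nth h i * fps_nth (inverse h) (n - i))"
      for h :: "'a fps"
      by (simp add: Suc fps_inverse_def)
    ultimately show ?thesis
      using less.prems[of 0] by simp
  qed
qed

lemma cf_denom_nth_eq:
  assumes "j \<le> N" "N \<le> M"
  shows "fps_nth (cf_denom l m M) j = fps_nth (cf_denom l m N) j"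
  using assms
proof (induction N arbitrary: M m j)
  case 0
  then show ?case by simp
next
  case (Suc N)
  then obtain M' where M: "M = Suc M'" "N \<le> M'" by (cases M) auto
  have *: "fps_nth (cf_denom l m (Suc K)) j = fps_nth 1 j -
            (if j = 0 then 0 else l m * fps_nth (inverse (cf_denom l (Suc m) K)) (j - 1))" for K
    by (simp add: fps_divide_unit mult.assoc)
  have "fps_nth (inverse (cf_denom l (Suc m) M')) (j - 1) =
        fps_nth (inverse (cf_denom l (Suc m) N)) (j - 1)"
    using Suc.prems(1) M(2) by (intro fps_inverse_nth_cong Suc.IH) auto
  then show ?case by (simp only: M *)
qed

lemma cf_trunc_nth_eq:
  assumes "n \<le> N"
  shows "fps_nth (cf_trunc l N) n = fps_nth (cf_trunc l n) n"
proof -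
  have "fps_nth (inverse (cf_denom l 1 N)) n = fps_nth (inverse (cf_denom l 1 n)) n"
    by (rule fps_inverse_nth_cong) (rule cf_denom_nth_eq[OF _ assms])
  then show ?thesis
    by (simp add: cf_trunc_def fps_divide_unit)
qed

lemma cf_trunc_tendsto_aux: "cf_trunc l \<longlonglongrightarrow> Abs_fps (\<lambda>n. fps_nth (cf_trunc l n) n)"
proof (rule tendsto_fpsI)
  fix n
  show "\<forall>\<^sub>F N in sequentially.
          fps_nth (cf_trunc l N) n = fps_nth (Abs_fps (\<lambda>n. fps_nth (cf_trunc l n) n)) n"
    unfolding fps_nth_Abs_fps
    using eventually_ge_at_top[of n] by eventually_elim (rule cf_trunc_nth_eq)
qed

lemma cf_trunc_tendsto: "cf_trunc l \<longlonglongrightarrow> cont_frac l"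
  using cf_trunc_tendsto_aux[of l] limI[OF cf_trunc_tendsto_aux[of l]]
  by (simp add: cont_frac_def)

lemma cf_nth_eq_trunc:
  assumes "n \<le> N"
  shows "fps_nth (cont_frac l) n = fps_nth (cf_trunc l N) n"
  using limI[OF cf_trunc_tendsto_aux[of l]] cf_trunc_nth_eq[OF assms, of l]
  by (simp add: cont_frac_def)

end

theory Submission
  imports Defs
begin

text \<open>
  After the factors \<open>1 - q\<close> are scaled out, the coefficients of the fraction are the moments
  \<open>L (X ^ n)\<close> of the continuous dual \<open>q\<close>-Hahn functional \<open>L\<close> in base \<open>p = q\<^sup>2\<close>, where
  \<open>X = (1 + u) (1 + 1 / u)\<close>. Let \<open>\<phi> k\<close> be the product of \<open>(1 + u p\<^sup>j) (1 + p\<^sup>j / u)\<close> over \<open>j < k\<close>;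
  then \<open>p\<^sup>k X \<phi> k = \<phi> (k + 1) - (1 - p\<^sup>k)\<^sup>2 \<phi> k\<close>. The numbers \<open>L (X ^ n \<phi> k)\<close> are thus determined
  by \<open>L (\<phi> k)\<close>, which is shown to be the product of the odd-indexed \<open>\<lambda>\<close>s up to \<open>2 k - 1\<close>, both
  for the functional defined by the continued fraction and for the one defined by the right-hand
  side. For the former, \<open>\<phi> k\<close> is expanded in the orthogonal polynomials. For the latter,
  \<open>X ^ n\<close> is expanded with ballot numbers in \<open>V j\<close>, the sum of \<open>u ^ i\<close> over \<open>-j \<le> i \<le> j\<close>, the
  functional is \<open>L (V j) = q ^ (j (j + 1)) \<Sum> y ^ i q ^ (- i\<^sup>2)\<close>, and the value of \<open>L (\<phi> k)\<close> is the
  finite Jacobi triple product.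
\<close>

section \<open>Lattice paths and the continued fraction\<close>

text \<open>
  Weighted lattice paths with \<open>N\<close> steps from height \<open>m\<close> to height \<open>0\<close>; an up step to height \<open>i\<close>
  has weight \<open>l i\<close>. Putting the weights on the up steps avoids dividing by them in \<open>walks_fps_rec\<close>.
\<close>

fun walks :: "(nat \<Rightarrow> 'a::comm_ring_1) \<Rightarrow> nat \<Rightarrow> nat \<Rightarrow> 'a" where
  "walks l 0 m = of_bool (m = 0)"
| "walks l (Suc N) 0 = l 1 * walks l N 1"
| "walks l (Suc N) (Suc m) = walks l N m + l (m + 2) * walks l N (m + 2)"

lemma walks_eq_0: "N < m \<Longrightarrow> walks l N m = 0"
  by (induction l N m rule: walks.induct) auto

text \<open>A path of \<open>m + 2 * n\<close> steps from height \<open>m\<close> to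
  \<open>0\<close> has exactly \<open>n\<close> up steps.\<close>

lemma walks_scale:
  "N = m + 2 * n \<Longrightarrow> walks (\<lambda>i. s * l i) N m = s ^ n * walks l N m"
proof (induction N arbitrary: m n)
  case 0
  then show ?case by simp
next
  case (Suc N)
  show ?case
  proof (cases m)
    case 0
    with Suc.prems obtain n' where n: "n = Suc n'" by (cases n) auto
    have "N = 1 + 2 * n'" using Suc.prems 0 n by simp
    then have "walks (\<lambda>i. s * l i) N 1 = s ^ n' * walks l N 1" by (rule Suc.IH)
    then show ?thesis unfolding 0 n by (simp add: mult_ac)
  next
    case (Suc m')
    have 1: "walks (\<lambda>i. s * l i) N m' = s ^ n * walks l N m'"
      using Suc.IH[of m' n] Suc.prems Suc by simp
    have 2: "s * walks (\<lambda>i. s * l i) N (m' + 2) = s ^ n * walks l N (m' + 2)"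
    proof (cases n)
      case 0
      then show ?thesis using Suc Suc.prems by (simp add: walks_eq_0)
    next
      case (Suc n')
      then show ?thesis
        using Suc.IH[of "m' + 2" n'] Suc.prems \<open>m = Suc m'\<close> by (simp add: mult.assoc)
    qed
    have "walks (\<lambda>i. s * l i) (Suc N) m =
        walks (\<lambda>i. s * l i) N m' + l (m' + 2) * (s * walks (\<lambda>i. s * l i) N (m' + 2))"
      unfolding Suc by (simp add: mult_ac)
    then show ?thesis
      unfolding 1 2 unfolding Suc by (simp add: algebra_simps)
  qed
qed

text \<open>The index is shifted by one: index \<open>Suc m\<close> belongs to starting height \<open>m\<close>.\<close>

fun walks_fps :: "(nat \<Rightarrow> 'a::comm_ring_1) \<Rightarrow> nat \<Rightarrow> 'a fps" where
  "walks_fps l 0 = 1"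
| "walks_fps l (Suc m) = Abs_fps (\<lambda>n. walks l (m + 2 * n) m)"

text \<open>Splits off the first step. For \<open>m = 0\<close> the term
  \<open>walks_fps l 0 = 1\<close> counts the empty path.\<close>

lemma walks_fps_rec:
  "walks_fps l (Suc m) = walks_fps l m + fps_const (l (Suc m)) * fps_X * walks_fps l (Suc (Suc m))"
proof (rule fps_ext)
  fix n
  show "fps_nth (walks_fps l (Suc m)) n =
    fps_nth (walks_fps l m + fps_const (l (Suc m)) * fps_X * walks_fps l (Suc (Suc m))) n"
    by (cases m; cases n) (auto simp: mult.assoc walks_eq_0)
qed

text \<open>Dividing \<open>walks_fps_rec\<close> by its left-hand side unrolls the quotient of
  consecutive series into a tail of the fraction; cutting after \<open>N\<close> numerators leaves
  an error of order \<open>N + 1\<close>.\<close>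

lemma walks_fps_mult_cf_denom:
  fixes l :: "nat \<Rightarrow> 'a::field"
  shows "\<exists>R. walks_fps l (Suc m) * cf_denom l (Suc m) N = walks_fps l m + fps_X ^ Suc N * R"
proof (induction N arbitrary: m)
  case 0
  show ?case
    by (rule exI[of _ "fps_const (l (Suc m)) * walks_fps l (Suc (Suc m))"])
      (simp add: walks_fps_rec[of l m] mult_ac del: walks_fps.simps)
next
  case (Suc N)
  define D where "D = cf_denom l (Suc (Suc m)) N"
  have D: "D * inverse D = 1"
    by (rule inverse_mult_eq_1') (simp add: D_def)
  obtain R where R: "walks_fps l (Suc (Suc m)) * D = walks_fps l (Suc m) + fps_X ^ Suc N * R"
    using Suc.IH[of "Suc m"] unfolding D_def by blast
  have "walks_fps l (Suc m) * inverse D =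
      walks_fps l (Suc (Suc m)) * (D * inverse D) - fps_X ^ Suc N * R * inverse D"
    unfolding mult.assoc[symmetric] R by (simp add: algebra_simps del: walks_fps.simps)
  then have 1: "walks_fps l (Suc m) * inverse D =
      walks_fps l (Suc (Suc m)) - fps_X ^ Suc N * R * inverse D"
    using D by simp
  have "walks_fps l (Suc m) * cf_denom l (Suc m) (Suc N) = walks_fps l (Suc m) -
      fps_const (l (Suc m)) * fps_X * (walks_fps l (Suc m) * inverse D)"
    by (simp add: fps_divide_unit D_def algebra_simps del: walks_fps.simps)
  also have "\<dots> = walks_fps l m + fps_X ^ Suc (Suc N) * (fps_const (l (Suc m)) * R * inverse D)"
    unfolding 1 by (subst (1) walks_fps_rec) (simp add: algebra_simps del: walks_fps.simps)
  finally show ?case by blast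
qed

lemma cont_frac_nth:
  fixes l :: "nat \<Rightarrow> 'a::field"
  shows "fps_nth (cont_frac l) n = walks l (2 * n) 0"
proof -
  define D where "D = cf_denom l (Suc 0) n"
  have D: "D * inverse D = 1"
    by (rule inverse_mult_eq_1') (simp add: D_def)
  obtain R where R: "walks_fps l (Suc 0) * D = 1 + fps_X ^ Suc n * R"
    using walks_fps_mult_cf_denom[of l 0 n] by (auto simp: D_def)
  have "walks_fps l (Suc 0) * (D * inverse D) = inverse D + fps_X ^ Suc n * (R * inverse D)"
    unfolding mult.assoc[symmetric] R by (simp add: algebra_simps)
  then have "inverse D = walks_fps l (Suc 0) - fps_X ^ Suc n * (R * inverse D)"
    using D by simp
  then have "fps_nth (inverse D) n =
      fps_nth (walks_fps l (Suc 0) - fps_X ^ Suc n * (R * inverse D)) n"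
    by (rule arg_cong)
  also have "\<dots> = walks l (2 * n) 0 - fps_nth (fps_X ^ Suc n * (R * inverse D)) n"
    by (simp only: fps_sub_nth walks_fps.simps(2) fps_nth_Abs_fps add_0)
  also have "fps_nth (fps_X ^ Suc n * (R * inverse D)) n = 0"
    by (subst fps_X_power_mult_nth) simp
  finally have "fps_nth (inverse D) n = walks l (2 * n) 0" by simp
  moreover have "cf_trunc l n = inverse D"
    by (simp add: cf_trunc_def fps_divide_unit D_def)
  ultimately show ?thesis
    using cf_nth_eq_trunc[of n n l] by simp
qed

definition lam_numer :: "'a::field \<Rightarrow> 'a \<Rightarrow> nat \<Rightarrow> 'a" where
  "lam_numer y q m = (if odd m then (1 + y * q ^ m) * (1 + inverse y * q ^ m) else (1 - q ^ m)\<^sup>2)"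

lemma lam_eq: "lam y q m = 1 / (1 - q)\<^sup>2 * lam_numer y q m"
  by (simp add: lam_def lam_numer_def power_divide)

lemma cont_frac_lam_nth:
  "fps_nth (cont_frac (lam y q)) n = 1 / (1 - q) ^ (2 * n) * walks (lam_numer y q) (2 * n) 0"
proof -
  have "lam y q = (\<lambda>i. 1 / (1 - q)\<^sup>2 * lam_numer y q i)"
    by (rule ext) (rule lam_eq)
  then show ?thesis
    using walks_scale[of "2 * n" 0 n "1 / (1 - q)\<^sup>2" "lam_numer y q"]
    by (simp add: cont_frac_nth power_divide power_mult)
qed

section \<open>The functional of the continued fraction\<close>

text \<open>
  The coefficient of the \<open>m\<close>-th orthogonal polynomial in \<open>\<phi> k / L (\<phi> k)\<close>. That the coefficient for
  \<open>m = 0\<close> is \<open>1\<close> gives \<open>L (\<phi> k)\<close>; \<open>conn_sum y q n k\<close> below is \<open>L (X ^ n \<phi> k) / L (\<phi> k)\<close>.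
\<close>

fun conn_coeff :: "'a::comm_ring_1 \<Rightarrow> nat \<Rightarrow> nat \<Rightarrow> 'a" where
  "conn_coeff p k 0 = 1"
| "conn_coeff p k (Suc m) = conn_coeff p k m * (1 - p ^ Suc m) * (p ^ m - p ^ k)"

lemma conn_coeff_eq_0: "k < m \<Longrightarrow> conn_coeff p k m = 0"
proof (induction m)
  case (Suc m)
  then show ?case by (cases "k = m") auto
qed simp

text \<open>From \<open>p ^ Suc i - p ^ Suc k = p * (p ^ i - p ^ k)\<close>; it puts the
  coefficients for \<open>k\<close> and \<open>Suc k\<close> over a common factor.\<close>

lemma conn_coeff_Suc_Suc:
  "conn_coeff p (Suc k) (Suc m) = conn_coeff p k m * (1 - p ^ Suc m) * p ^ m * (1 - p ^ Suc k)"
proof (induction m)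
  case (Suc m)
  have "conn_coeff p (Suc k) (Suc (Suc m)) =
     conn_coeff p (Suc k) (Suc m) * (1 - p ^ Suc (Suc m)) * (p ^ Suc m - p ^ Suc k)" by simp
  then show ?case unfolding Suc by (simp add: algebra_simps)
qed simp

lemma lam_numer_odd:
  "y \<noteq> 0 \<Longrightarrow> lam_numer y q (Suc (2 * m)) = 1 + q * (y + inverse y) * (q\<^sup>2) ^ m + q\<^sup>2 * ((q\<^sup>2) ^ m)\<^sup>2"
  by (simp add: lam_numer_def field_simps power_mult power2_eq_square)

lemma lam_numer_even: "lam_numer y q (2 * m) = (1 - (q\<^sup>2) ^ m)\<^sup>2"
  by (simp add: lam_numer_def power_mult)

text \<open>Two steps at a time give a three-term recurrence on even heights.\<close>

lemma walks_even_0: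
  "walks l (2 * Suc n) 0 = l 1 * (walks l (2 * n) 0 + l 2 * walks l (2 * n) (2 * 1))"
  by (simp add: numeral_2_eq_2)

lemma walks_even_Suc:
  "walks l (2 * Suc n) (2 * Suc m) = walks l (2 * n) (2 * m) + l (2 * Suc m) * walks l (2 * n) (2 * Suc m)
     + l (Suc (2 * Suc m)) * (walks l (2 * n) (2 * Suc m) + l (2 * Suc (Suc m)) * walks l (2 * n) (2 * Suc (Suc m)))"
  by (simp add: numeral_2_eq_2)

definition conn_sum :: "'a::field \<Rightarrow> 'a \<Rightarrow> nat \<Rightarrow> nat \<Rightarrow> 'a" where
  "conn_sum y q n k = (\<Sum>m\<le>k. conn_coeff (q\<^sup>2) k m * walks (lam_numer y q) (2 * n) (2 * m))"

text \<open>Partial sums for \<open>conn_sum_rec\<close>, with the boundary term that makes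
  induction on \<open>J\<close> work.\<close>

lemma conn_sum_partial:
  fixes y q :: "'a::field"
  assumes "y \<noteq> 0"
  defines "p \<equiv> q\<^sup>2" and "l \<equiv> lam_numer y q"
  shows "p ^ k * (\<Sum>m\<le>J. conn_coeff p k m * walks l (2 * Suc n) (2 * m)) =
    (\<Sum>m\<le>J. (l (Suc (2 * k)) * conn_coeff p (Suc k) m - (1 - p ^ k)\<^sup>2 * conn_coeff p k m)
               * walks l (2 * n) (2 * m))
    + p ^ k * (conn_coeff p k J * l (Suc (2 * J)) * l (2 * Suc J) * walks l (2 * n) (2 * Suc J)
               - conn_coeff p k (Suc J) * walks l (2 * n) (2 * J))"
proof (induction J)
  case 0
  have l: "l (Suc 0) = 1 + q * (y + inverse y) + p" "l 2 = (1 - p)\<^sup>2"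
      "l (Suc (2 * k)) = 1 + q * (y + inverse y) * p ^ k + p * (p ^ k)\<^sup>2"
    using lam_numer_odd[OF assms(1), of q 0] lam_numer_odd[OF assms(1), of q k] lam_numer_even[of y q 1]
    by (simp_all add: l_def p_def)
  have w: "walks l (2 * Suc n) 0 = l (Suc 0) * (walks l (2 * n) 0 + l 2 * walks l (2 * n) 2)"
    using walks_even_0[of l n] by simp
  have two: "2 * Suc 0 = 2" by simp
  show ?case
    by (simp add: w l two del: walks.simps mult_Suc_right) (simp add: algebra_simps power2_eq_square)
next
  case (Suc J)
  define K M t a where "K = p ^ k" and "M = p ^ J" and "t = q * (y + inverse y)"
    and "a = conn_coeff p k J"
  have l: "l (Suc (2 * J)) = 1 + t * M + p * M\<^sup>2" "l (Suc (2 * Suc J)) = 1 + t * (p * M) + p * (p * M)\<^sup>2"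
      "l (2 * Suc J) = (1 - p * M)\<^sup>2" "l (Suc (2 * k)) = 1 + t * K + p * K\<^sup>2"
    using lam_numer_odd[OF assms(1), of q J] lam_numer_odd[OF assms(1), of q k]
      lam_numer_odd[OF assms(1), of q "Suc J"] lam_numer_even[of y q "Suc J"]
    by (simp_all add: l_def p_def K_def M_def t_def)
  have c: "conn_coeff p k (Suc J) = a * (1 - p * M) * (M - K)"
      "conn_coeff p k (Suc (Suc J)) = a * (1 - p * M) * (M - K) * (1 - p * (p * M)) * (p * M - K)"
      "conn_coeff p (Suc k) (Suc J) = a * (1 - p * M) * M * (1 - p * K)"
    unfolding conn_coeff_Suc_Suc by (simp_all add: a_def K_def M_def)
  \<comment> \<open>All terms of \<open>key\<close> share the factor \<open>a * e\<close> with
    \<open>e = 1 - p * M\<close>; what remains is polynomial in \<open>K\<close>, \<open>M\<close>,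
    \<open>p\<close>, \<open>t\<close>.\<close>
  have scale: "K * (a * L * e\<^sup>2) + K * (a * e * d * (e\<^sup>2 + l3)) =
      A * (a * e * M * f) - g * (a * e * d) - K * (a * e * d * h * r)"
    if "K * (L * e) + K * (d * (e\<^sup>2 + l3)) = A * (M * f) - g * d - K * (d * h * r)"
    for L e d l3 A f g h r :: 'a
    using arg_cong[OF that, of "\<lambda>x. a * e * x"] by (simp add: algebra_simps power2_eq_square)
  have key: "K * (a * l (Suc (2 * J)) * l (2 * Suc J))
      + K * (conn_coeff p k (Suc J) * (l (2 * Suc J) + l (Suc (2 * Suc J)))) =
      l (Suc (2 * k)) * conn_coeff p (Suc k) (Suc J) - (1 - K)\<^sup>2 * conn_coeff p k (Suc J)
      - K * conn_coeff p k (Suc (Suc J))"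
  proof -
    have "K * ((1 + t * M + p * M\<^sup>2) * (1 - p * M))
        + K * ((M - K) * ((1 - p * M)\<^sup>2 + (1 + t * (p * M) + p * (p * M)\<^sup>2))) =
        (1 + t * K + p * K\<^sup>2) * (M * (1 - p * K)) - (1 - K)\<^sup>2 * (M - K)
        - K * ((M - K) * (1 - p * (p * M)) * (p * M - K))"
      by algebra
    from scale[OF this] show ?thesis
      unfolding c l .
  qed
  have step: "(S + K * (a * l1 * l2 * w1 - c1 * w0))
        + K * (c1 * (w0 + l2 * w1 + l3 * (w1 + l4 * w2))) =
      S + (A * d - E * c1) * w1 + K * (c1 * l3 * l4 * w2 - c2 * w1)"
    if "K * (a * l1 * l2) + K * (c1 * (l2 + l3)) = A * d - E * c1 - K * c2"
    for S l1 l2 l3 l4 w0 w1 w2 c1 c2 A d E :: 'a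
    using arg_cong[OF that, of "\<lambda>x. x * w1"] by (simp add: algebra_simps)
  show ?case
    unfolding sum.atMost_Suc distrib_left[of "p ^ k" "sum _ _"] Suc walks_even_Suc
    unfolding K_def[symmetric] a_def[symmetric]
    by (rule step[OF key])
qed

text \<open>The rule for \<open>X \<phi> k\<close> under \<open>L\<close>, divided by
  \<open>L (\<phi> k)\<close>.\<close>

lemma conn_sum_rec:
  assumes "y \<noteq> 0"
  shows "(q\<^sup>2) ^ k * conn_sum y q (Suc n) k =
    lam_numer y q (Suc (2 * k)) * conn_sum y q n (Suc k) - (1 - (q\<^sup>2) ^ k)\<^sup>2 * conn_sum y q n k"
proof -
  have "conn_sum y q n k = (\<Sum>m\<le>Suc k. conn_coeff (q\<^sup>2) k m * walks (lam_numer y q) (2 * n) (2 * m))" for n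
    unfolding conn_sum_def sum.atMost_Suc by (subst (2) conn_coeff_eq_0) simp_all
  \<comment> \<open>\<open>J = Suc k\<close> is past the last nonzero coefficient, so the boundary
    term vanishes.\<close>
  moreover note conn_sum_partial[OF assms, where q = q and k = k and J = "Suc k" and n = n]
  ultimately show ?thesis
    by (simp add: conn_coeff_eq_0 conn_sum_def[of y q n "Suc k"] left_diff_distrib sum_subtractf
        sum_distrib_left mult.assoc del: sum.atMost_Suc walks.simps conn_coeff.simps mult_Suc_right)
qed

lemma conn_sum_0: "conn_sum y q 0 k = 1"
proof -
  have "conn_sum y q 0 k = (\<Sum>m\<le>k. if m = 0 then 1 else 0)"
    unfolding conn_sum_def by (intro sum.cong) auto
  then show ?thesis by simp
qed

section \<open>Central Gaussian binomials\<close>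

text \<open>
  \<open>cbinom p k i\<close> is the Gaussian binomial coefficient \<open>[2 k, k + i]\<close> in base \<open>p\<close>. The recursion is
  the one satisfied by the coefficients of the finite triple product.
\<close>

fun cbinom :: "'a::field \<Rightarrow> nat \<Rightarrow> int \<Rightarrow> 'a" where
  "cbinom p 0 i = of_bool (i = 0)"
| "cbinom p (Suc k) i = (1 + p ^ (2 * k + 1)) * cbinom p k i
     + p powi (int k + 1 - i) * cbinom p k (i - 1) + p powi (int k + 1 + i) * cbinom p k (i + 1)"

lemma cbinom_eq_0: "int k < \<bar>i\<bar> \<Longrightarrow> cbinom p k i = 0"
  by (induction k arbitrary: i) auto

lemma cbinom_minus: "cbinom p k (- i) = cbinom p k i"
proof (induction k arbitrary: i)
  case (Suc k)
  have "cbinom p k (- i - 1) = cbinom p k (i + 1)" "cbinom p k (- i + 1) = cbinom p k (i - 1)"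
    using Suc[of "i + 1"] Suc[of "i - 1"] by (simp_all add: minus_diff_commute)
  then show ?case by (simp add: Suc algebra_simps)
qed simp

lemma cbinom_ratio:
  assumes "p \<noteq> 0"
  shows "(1 - p powi (int k - i)) * cbinom p k i = (1 - p powi (int k + i + 1)) * cbinom p k (i + 1)"
proof (induction k arbitrary: i)
  case 0
  then show ?case by auto
next
  case (Suc k)
  define u v where "u = p powi (int k - i)" and "v = p powi (int k + i)"
  have P: "p ^ (2 * k) = u * v"
    using assms power_int_add[of p "int k - i" "int k + i"] power_int_of_nat[of p "2 * k"]
    by (simp add: u_def v_def)
  have e: "p powi (int (Suc k) - i) = p * u" "p powi (int (Suc k) + i + 1) = p * (p * v)"
     "p powi (int k + 1 - i) = p * u" "p powi (int k + 1 + i) = p * v"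
     "p powi (int k + 1 - (i + 1)) = u" "p powi (int k + 1 + (i + 1)) = p * (p * v)"
    using assms by (simp_all add: u_def v_def power_int_add power_int_diff power2_eq_square)
  have 1: "(1 - u) * cbinom p k i = (1 - p * v) * cbinom p k (i + 1)"
    using Suc[of i] assms by (simp add: u_def v_def power_int_add)
  have 2: "(1 - p * u) * cbinom p k (i - 1) = (1 - v) * cbinom p k i"
    using Suc[of "i - 1"] assms by (simp add: u_def v_def power_int_add power_int_diff mult.commute)
  have 3: "(p - u) * cbinom p k (i + 1) = (p - p * (p * (p * v))) * cbinom p k (i + 2)"
    using Suc[of "i + 1"] assms by (simp add: u_def v_def power_int_add power_int_diff field_simps power2_eq_square)
  \<comment> \<open>The difference of the two sides for \<open>Suc k\<close> combines those for
    \<open>k\<close> at \<open>i\<close>, \<open>i - 1\<close>, \<open>i + 1\<close>;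
    \<open>b0\<close> to \<open>b3\<close> are the values at \<open>i - 1\<close> to
    \<open>i + 2\<close>.\<close>
  have "(1 - p * u) * ((1 + p * (u * v)) * b1 + p * u * b0 + p * v * b2)
      - (1 - p * (p * v)) * ((1 + p * (u * v)) * b2 + u * b1 + p * (p * v) * b3) =
      (1 + p * (p * (u * v))) * ((1 - u) * b1 - (1 - p * v) * b2)
      + p * u * ((1 - p * u) * b0 - (1 - v) * b1)
      + p * v * ((p - u) * b2 - (p - p * (p * (p * v))) * b3)" for b0 b1 b2 b3
    by (simp add: algebra_simps)
  from this[of "cbinom p k i" "cbinom p k (i - 1)" "cbinom p k (i + 1)" "cbinom p k (i + 2)"]
  show ?case
    unfolding cbinom.simps e 1 2 3 by (simp add: P add.assoc)
qed

section \<open>Expansion in the \<open>V j\<close>\<close>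

text \<open>
  The coefficient of \<open>V j\<close> in \<open>\<phi> k\<close>, in the form that makes the sum against
  \<open>q ^ (j (j + 1)) * theta y q j\<close> telescope.
\<close>

definition sym_coeff :: "'a::field \<Rightarrow> nat \<Rightarrow> int \<Rightarrow> 'a" where
  "sym_coeff q k j = q powi (j * (j - 1)) * cbinom (q\<^sup>2) k j
     - q powi ((j + 1) * (j + 2)) * cbinom (q\<^sup>2) k (j + 1)"

text \<open>The rule for \<open>p\<^sup>k X \<phi> k\<close>, read off at
  \<open>V j\<close>.\<close>

lemma sym_coeff_Suc:
  assumes "q \<noteq> 0"
  shows "sym_coeff q (Suc k) j = (1 - (q\<^sup>2) ^ k)\<^sup>2 * sym_coeff q k j
     + (q\<^sup>2) ^ k * (sym_coeff q k (j - 1) + 2 * sym_coeff q k j + sym_coeff q k (j + 1))"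
proof -
  define B where "B = cbinom (q\<^sup>2) k"
  define K s T where "K = (q\<^sup>2) ^ k" and "s = q powi (2 * j)" and "T = q powi (j * (j - 1))"
  have K: "K = q powi (2 * int k)"
    unfolding K_def power_mult[symmetric] by (simp flip: power_int_of_nat)
  have s0: "s \<noteq> 0" using assms by (simp add: s_def)
  have p: "(q\<^sup>2) powi i = q powi (2 * i)" for i
    by (simp add: power_int_mult)
  define a where "a = q powi j"
  have m: "q powi (j * 2) = a * a" "q powi (j * 3) = a * a * a" "q powi (j * 4) = a * a * a * a"
      "q powi (j * 5) = a * a * a * a * a" "q powi j = a" "a \<noteq> 0"
    using assms by (simp_all add: a_def power_int_mult eval_nat_numeral mult_ac)
  have T: "q powi ((j + 1) * (j + 2)) = T * s\<^sup>2 * q\<^sup>2"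
      "q powi ((j - 1) * (j - 1 - 1)) = T / s * q\<^sup>2"
      "q powi ((j - 1 + 1) * (j - 1 + 2)) = T * s"
      "q powi ((j + 1) * (j + 1 - 1)) = T * s"
      "q powi ((j + 1 + 1) * (j + 1 + 2)) = T * s ^ 3 * q ^ 6"
    unfolding T_def s_def using assms m
    by (simp_all add: algebra_simps power_int_add power_int_diff)
      (simp_all add: field_simps eval_nat_numeral)
  have e: "(q\<^sup>2) powi (int k + 1 - j) = K * q\<^sup>2 / s" "(q\<^sup>2) powi (int k + 1 + j) = K * q\<^sup>2 * s"
     "(q\<^sup>2) powi (int k + 1 - (j + 1)) = K / s" "(q\<^sup>2) powi (int k + 1 + (j + 1)) = K * q ^ 4 * s"
    using assms unfolding p
    by (simp_all add: K s_def power_int_add power_int_diff distrib_left right_diff_distrib)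
  have e': "(q\<^sup>2) ^ (2 * k + 1) = K\<^sup>2 * q\<^sup>2"
    by (simp add: K_def power_mult power2_eq_square power_mult_distrib)
  have "(1 - K / s) * B j = (1 - K * s * q\<^sup>2) * B (j + 1)"
    using cbinom_ratio[of "q\<^sup>2" k j] assms unfolding p
    by (simp add: K s_def B_def power_int_add power_int_diff algebra_simps)
  then have r: "(s - K) * B j = (s - K * s\<^sup>2 * q\<^sup>2) * B (j + 1)"
    using s0 by (simp add: field_simps power2_eq_square)
  \<comment> \<open>The two sides differ by a multiple of the relation \<open>r\<close>, which is
    \<open>cbinom_ratio\<close>.\<close>
  have "T * ((1 + K\<^sup>2 * q\<^sup>2) * b1 + K * q\<^sup>2 / s * b0 + K * q\<^sup>2 * s * b2)
      - T * s\<^sup>2 * q\<^sup>2 * ((1 + K\<^sup>2 * q\<^sup>2) * b2 + K / s * b1 + K * q ^ 4 * s * b3)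
      - ((1 - K)\<^sup>2 * (T * b1 - T * s\<^sup>2 * q\<^sup>2 * b2)
         + K * ((T / s * q\<^sup>2 * b0 - T * s * b1) + 2 * (T * b1 - T * s\<^sup>2 * q\<^sup>2 * b2)
             + (T * s * b2 - T * s ^ 3 * q ^ 6 * b3)))
      = (1 - q\<^sup>2) * K * T * ((s - K) * b1 - (s - K * s\<^sup>2 * q\<^sup>2) * b2)" for b0 b1 b2 b3
    using s0 by (simp add: field_simps) (simp add: eval_nat_numeral algebra_simps)
  from this[of "B j" "B (j - 1)" "B (j + 1)" "B (j + 2)"]
  show ?thesis
    unfolding sym_coeff_def cbinom.simps T e e' B_def[symmetric] K_def[symmetric] T_def[symmetric] r
    by (simp add: add.assoc)
qed

lemma sym_coeff_eq_0: "int k < j \<Longrightarrow> sym_coeff q k j = 0"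
  by (simp add: sym_coeff_def cbinom_eq_0)

text \<open>
  The coefficient of \<open>V j\<close> in \<open>X ^ n \<phi> k\<close>. With \<open>V (-1 - j) = - V j\<close> the rule
  \<open>X V j = V (j - 1) + 2 V j + V (j + 1)\<close> holds for every integer \<open>j\<close>.
\<close>

fun sym_shift :: "'a::field \<Rightarrow> nat \<Rightarrow> nat \<Rightarrow> int \<Rightarrow> 'a" where
  "sym_shift q 0 k j = sym_coeff q k j"
| "sym_shift q (Suc n) k j = sym_shift q n k (j - 1) + 2 * sym_shift q n k j + sym_shift q n k (j + 1)"

lemma sym_shift_eq_0: "int n + int k < j \<Longrightarrow> sym_shift q n k j = 0"
  by (induction n arbitrary: j) (auto simp: sym_coeff_eq_0)

lemma sym_shift_Suc:
  assumes "q \<noteq> 0"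
  shows "(q\<^sup>2) ^ k * sym_shift q (Suc n) k j = sym_shift q n (Suc k) j - (1 - (q\<^sup>2) ^ k)\<^sup>2 * sym_shift q n k j"
proof (induction n arbitrary: j)
  case 0
  show ?case using sym_coeff_Suc[OF assms, of k j] by (simp add: algebra_simps)
next
  case (Suc n)
  have "(q\<^sup>2) ^ k * sym_shift q (Suc (Suc n)) k j = (q\<^sup>2) ^ k * sym_shift q (Suc n) k (j - 1) +
     2 * ((q\<^sup>2) ^ k * sym_shift q (Suc n) k j) + (q\<^sup>2) ^ k * sym_shift q (Suc n) k (j + 1)"
    by (simp only: sym_shift.simps(2)[of q "Suc n"]) (simp add: algebra_simps)
  then show ?case unfolding Suc by (simp add: algebra_simps)
qed

lemma binom_pascal: "binom (Suc a) b = binom a b + binom a (b - 1)"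
proof (cases "b \<le> 0")
  case True
  then show ?thesis by (cases "b = 0") (auto simp: binom_def)
next
  case False
  then obtain c where "b = int (Suc c)" by (metis not_le zero_less_imp_eq_int gr0_implies_Suc)
  then show ?thesis by (simp add: binom_def nat_add_distrib)
qed

text \<open>Reflection principle: \<open>sym_coeff q 0\<close> is \<open>1\<close> at
  \<open>0\<close> and \<open>-1\<close> at \<open>-1\<close>, and each factor \<open>X\<close> acts
  as two half-unit steps of a simple walk.\<close>

lemma sym_shift_0_eq_binom:
  "sym_shift q n 0 j = of_nat (binom (2 * n) (int n - j)) - of_nat (binom (2 * n) (int n - j - 1))"
proof (induction n arbitrary: j)
  case 0
  consider "j = 0" | "j = - 1" | "j > 0" | "j < - 1" by linarith
  then show ?case
  proof cases
    case 4
    then show ?thesis by (simp add: sym_coeff_def binom_def binomial_eq_0)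
  qed (simp_all add: sym_coeff_def binom_def)
next
  case (Suc n)
  have [simp]: "2 * Suc n = Suc (Suc (2 * n))" by simp
  show ?case unfolding sym_shift.simps Suc
    by (simp add: binom_pascal algebra_simps)
qed


section \<open>Theta sums and the finite triple product\<close>

definition theta :: "'a::field \<Rightarrow> 'a \<Rightarrow> nat \<Rightarrow> 'a" where
  "theta y q j = (\<Sum>i=-int j..int j. y powi i * q powi (- (i\<^sup>2)))"

lemma sum_sym_Suc:
  fixes F :: "int \<Rightarrow> 'a::comm_monoid_add"
  shows "(\<Sum>i=-int (Suc J)..int (Suc J). F i) =
    (\<Sum>i=-int J..int J. F i) + (F (int (Suc J)) + F (- int (Suc J)))"
proof -
  have "{-int (Suc J)..int (Suc J)} = insert (int (Suc J)) (insert (- int (Suc J)) {-int J..int J})"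
    by auto
  then show ?thesis by (simp add: add_ac)
qed

text \<open>Summation by parts: the factor before \<open>theta y q j\<close> is a difference
  \<open>M j - M (j + 1)\<close>, and \<open>theta\<close> grows by the terms at \<open>j\<close>
  and \<open>- j\<close>.\<close>

lemma sum_sym_coeff_partial:
  fixes y q :: "'a::field"
  assumes "q \<noteq> 0"
  shows "(\<Sum>j=0..J. sym_coeff q k (int j) * q ^ (j * (j + 1)) * theta y q j) =
    (\<Sum>i=-int J..int J. q powi (i\<^sup>2) * cbinom (q\<^sup>2) k i * y powi i)
    - q powi (2 * (int J + 1)\<^sup>2) * cbinom (q\<^sup>2) k (int J + 1) * theta y q J"
proof -
  define M where "M j = q powi (2 * j\<^sup>2) * cbinom (q\<^sup>2) k j" for j
  have b: "sym_coeff q k (int j) * q ^ (j * (j + 1)) = M (int j) - M (int j + 1)" for j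
  proof -
    have 1: "q ^ (j * (j + 1)) = q powi (int j * (int j + 1))"
      by (simp flip: power_int_of_nat add: algebra_simps)
    have 2: "q powi (int j * (int j - 1)) * q ^ (j * (j + 1)) = q powi (2 * (int j)\<^sup>2)"
      unfolding 1 using assms
      by (simp flip: power_int_add add: algebra_simps power2_eq_square)
    have 3: "q powi ((int j + 1) * (int j + 2)) * q ^ (j * (j + 1)) = q powi (2 * (int j + 1)\<^sup>2)"
      unfolding 1 using assms
      by (simp flip: power_int_add add: algebra_simps power2_eq_square)
    show ?thesis
      unfolding sym_coeff_def M_def 2[symmetric] 3[symmetric]
      by (simp only: left_diff_distrib right_diff_distrib mult_ac)
  qed
  have t: "M (int (Suc J)) * (theta y q (Suc J) - theta y q J) =
      q powi ((int (Suc J))\<^sup>2) * cbinom (q\<^sup>2) k (int (Suc J)) * y powi (int (Suc J))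
      + q powi ((- int (Suc J))\<^sup>2) * cbinom (q\<^sup>2) k (- int (Suc J)) * y powi (- int (Suc J))" for J
  proof -
    have "q powi (2 * (int (Suc J))\<^sup>2) * q powi (- ((int (Suc J))\<^sup>2)) = q powi ((int (Suc J))\<^sup>2)"
      using assms by (simp flip: power_int_add del: of_nat_Suc)
    note e = this
    have "M (int (Suc J)) * (theta y q (Suc J) - theta y q J) =
        (q powi (2 * (int (Suc J))\<^sup>2) * q powi (- ((int (Suc J))\<^sup>2))) * cbinom (q\<^sup>2) k (int (Suc J))
        * (y powi (int (Suc J)) + y powi (- int (Suc J)))"
      unfolding M_def theta_def sum_sym_Suc
      by (simp add: algebra_simps del: of_nat_Suc)
    then show ?thesis unfolding e
      by (simp add: cbinom_minus algebra_simps del: of_nat_Suc)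
  qed
  have "(\<Sum>j=0..J. (M (int j) - M (int j + 1)) * theta y q j) =
    (\<Sum>i=-int J..int J. q powi (i\<^sup>2) * cbinom (q\<^sup>2) k i * y powi i) - M (int J + 1) * theta y q J"
  proof (induction J)
    case 0
    show ?case by (simp add: M_def theta_def)
  next
    case (Suc J)
    show ?case
      unfolding sum.atLeast0_atMost_Suc Suc sum_sym_Suc t[symmetric]
      by (simp add: algebra_simps)
  qed
  then show ?thesis
    unfolding b by (simp add: M_def)
qed

lemma sum_int_shift:
  fixes F :: "int \<Rightarrow> 'a::comm_monoid_add"
  assumes "\<And>i. k < \<bar>i\<bar> \<Longrightarrow> F i = 0" "\<bar>d\<bar> \<le> N - k"
  shows "(\<Sum>i=-N..N. F (i + d)) = (\<Sum>i=-k..k. F i)"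
proof -
  have "(\<Sum>i=-N..N. F (i + d)) = (\<Sum>i=-N+d..N+d. F i)"
    by (rule sum.reindex_bij_witness[of _ "\<lambda>i. i - d" "\<lambda>i. i + d"]) auto
  also have "\<dots> = (\<Sum>i=-k..k. F i)"
    using assms by (intro sum.mono_neutral_right) auto
  finally show ?thesis .
qed

text \<open>A new factor mixes the coefficients at \<open>i - 1\<close>, \<open>i\<close>,
  \<open>i + 1\<close> as the recursion of \<open>cbinom\<close> does.\<close>

lemma cbinom_triple_product:
  fixes y q :: "'a::field"
  assumes "q \<noteq> 0" "y \<noteq> 0"
  shows "(\<Sum>i=-int k..int k. q powi (i\<^sup>2) * cbinom (q\<^sup>2) k i * y powi i) =
    (\<Prod>m<k. 1 + q * (y + inverse y) * (q\<^sup>2) ^ m + q\<^sup>2 * ((q\<^sup>2) ^ m)\<^sup>2)"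
proof (induction k)
  case 0
  show ?case by simp
next
  case (Suc k)
  define F where "F i = q powi (i\<^sup>2) * cbinom (q\<^sup>2) k i * y powi i" for i
  define K where "K = (q\<^sup>2) ^ k"
  have F0: "F i = 0" if "int k < \<bar>i\<bar>" for i
    using that by (simp add: F_def cbinom_eq_0)
  have K: "K = q powi (2 * int k)"
    unfolding K_def power_mult[symmetric] by (simp flip: power_int_of_nat)
  have p: "(q\<^sup>2) powi i = q powi (2 * i)" for i
    by (simp add: power_int_mult)
  have F: "q powi (i\<^sup>2) * cbinom (q\<^sup>2) (Suc k) i * y powi i =
      (1 + q\<^sup>2 * K\<^sup>2) * F (i + 0) + q * K * y * F (i + (-1)) + q * K * inverse y * F (i + 1)" for i
  proof -
    \<comment> \<open>Completing the square:
      \<open>i\<^sup>2 + 2 * (k + 1 - i) = 2 * k + 1 + (i - 1)\<^sup>2\<close>.\<close>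
    have 1: "q powi (i\<^sup>2) * (q\<^sup>2) powi (int k + 1 - i) = q * K * q powi ((i - 1)\<^sup>2)"
      "q powi (i\<^sup>2) * (q\<^sup>2) powi (int k + 1 + i) = q * K * q powi ((i + 1)\<^sup>2)"
      unfolding p K using assms
      by (simp_all add: power2_eq_square algebra_simps power_int_add power_int_diff)
    have 2: "y powi i = y * y powi (i - 1)" "y powi i = inverse y * y powi (i + 1)"
      using assms by (simp_all add: power_int_add power_int_diff)
    have "q powi (i\<^sup>2) * cbinom (q\<^sup>2) (Suc k) i * y powi i =
        (1 + q\<^sup>2 * K\<^sup>2) * F i
        + (q powi (i\<^sup>2) * (q\<^sup>2) powi (int k + 1 - i)) * cbinom (q\<^sup>2) k (i - 1) * y powi i
        + (q powi (i\<^sup>2) * (q\<^sup>2) powi (int k + 1 + i)) * cbinom (q\<^sup>2) k (i + 1) * y powi i"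
      by (simp add: F_def K_def algebra_simps power_mult power2_eq_square power_mult_distrib)
    also have "(q powi (i\<^sup>2) * (q\<^sup>2) powi (int k + 1 - i)) * cbinom (q\<^sup>2) k (i - 1) * y powi i
        = q * K * y * F (i + (-1))"
      unfolding 1 by (subst 2(1)) (simp add: F_def mult_ac)
    also have "(q powi (i\<^sup>2) * (q\<^sup>2) powi (int k + 1 + i)) * cbinom (q\<^sup>2) k (i + 1) * y powi i
        = q * K * inverse y * F (i + 1)"
      unfolding 1 by (subst 2(2)) (simp add: F_def mult_ac)
    finally show ?thesis by simp
  qed
  have "(\<Sum>i=-int (Suc k)..int (Suc k). q powi (i\<^sup>2) * cbinom (q\<^sup>2) (Suc k) i * y powi i) =
     (1 + q\<^sup>2 * K\<^sup>2) * (\<Sum>i=-int (Suc k)..int (Suc k). F (i + 0))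
     + q * K * y * (\<Sum>i=-int (Suc k)..int (Suc k). F (i + (-1)))
     + q * K * inverse y * (\<Sum>i=-int (Suc k)..int (Suc k). F (i + 1))"
    unfolding F by (simp only: sum.distrib sum_distrib_left)
  also have "\<dots> = (1 + q\<^sup>2 * K\<^sup>2) * (\<Sum>i=-int k..int k. F i)
     + q * K * y * (\<Sum>i=-int k..int k. F i) + q * K * inverse y * (\<Sum>i=-int k..int k. F i)"
    using sum_int_shift[of "int k" F 0 "int (Suc k)"] sum_int_shift[of "int k" F 1 "int (Suc k)"]
      sum_int_shift[of "int k" F "-1" "int (Suc k)"] F0 by simp
  also have "\<dots> = (\<Sum>i=-int k..int k. F i) * (1 + q * (y + inverse y) * K + q\<^sup>2 * K\<^sup>2)"
    by (simp add: algebra_simps)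
  finally show ?case
    using Suc by (simp add: F_def K_def)
qed

section \<open>Comparison of the two functionals\<close>

text \<open>Both sides are \<open>L (X ^ n \<phi> k)\<close> and obey the same recursion, which
  lowers \<open>n\<close> but may raise \<open>k\<close>; \<open>n = 0\<close> is the triple
  product.\<close>

lemma sum_sym_shift_eq_conn_sum:
  fixes y q :: "'a::field"
  assumes "q \<noteq> 0" "y \<noteq> 0"
  shows "(\<Sum>j=0..n+k. sym_shift q n k (int j) * q ^ (j * (j + 1)) * theta y q j) =
    (\<Prod>m<k. lam_numer y q (Suc (2 * m))) * conn_sum y q n k"
proof (induction n arbitrary: k)
  case 0
  have "(\<Sum>j=0..k. sym_coeff q k (int j) * q ^ (j * (j + 1)) * theta y q j) =
      (\<Prod>m<k. lam_numer y q (Suc (2 * m)))"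
    unfolding sum_sym_coeff_partial[OF assms(1)] cbinom_triple_product[OF assms]
      lam_numer_odd[OF assms(2)]
    by (simp add: cbinom_eq_0)
  then show ?case by (simp add: conn_sum_0)
next
  case (Suc n)
  define K where "K = (q\<^sup>2) ^ k"
  define u where "u j = q ^ (j * (j + 1)) * theta y q j" for j
  have IH: "(\<Sum>j=0..n+k. sym_shift q n k (int j) * u j) =
      (\<Prod>m<k. lam_numer y q (Suc (2 * m))) * conn_sum y q n k" for k
    using Suc[of k] by (simp add: u_def mult.assoc)
  have "K * (\<Sum>j=0..Suc n+k. sym_shift q (Suc n) k (int j) * u j) =
      (\<Sum>j=0..Suc n+k. (K * sym_shift q (Suc n) k (int j)) * u j)"
    by (simp only: sum_distrib_left mult.assoc)
  also have "\<dots> = (\<Sum>j=0..n+Suc k. sym_shift q n (Suc k) (int j) * u j)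
      - (1 - K)\<^sup>2 * (\<Sum>j=0..Suc (n+k). sym_shift q n k (int j) * u j)"
    unfolding K_def sym_shift_Suc[OF assms(1)]
    by (simp only: left_diff_distrib sum_subtractf sum_distrib_left mult.assoc add_Suc add_Suc_right)
  also have "(\<Sum>j=0..Suc (n+k). sym_shift q n k (int j) * u j) =
      (\<Sum>j=0..n+k. sym_shift q n k (int j) * u j)"
    by (simp add: sym_shift_eq_0)
  also have "(\<Sum>j=0..n+Suc k. sym_shift q n (Suc k) (int j) * u j) - (1 - K)\<^sup>2 * \<dots> =
      (\<Prod>m<k. lam_numer y q (Suc (2 * m))) * (lam_numer y q (Suc (2 * k)) * conn_sum y q n (Suc k)
        - (1 - K)\<^sup>2 * conn_sum y q n k)"
    unfolding IH by (simp add: algebra_simps)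
  also have "\<dots> = K * ((\<Prod>m<k. lam_numer y q (Suc (2 * m))) * conn_sum y q (Suc n) k)"
    unfolding K_def conn_sum_rec[OF assms(2), symmetric] by (simp only: mult_ac)
  finally show ?case
    using assms(1) by (simp add: K_def u_def mult.assoc)
qed

text \<open>The case \<open>k = 0\<close>, where the product is empty and \<open>conn_sum\<close>
  has a single term.\<close>

theorem cont_frac_lam_nth_eq:
  fixes y q :: "'a::field"
  assumes "q \<noteq> 0" "y \<noteq> 0"
  shows "fps_nth (cont_frac (lam y q)) n =
           1 / (1 - q) ^ (2 * n) *
           (\<Sum>k=0..n.
              (of_nat (binom (2 * n) (int n - int k)) - of_nat (binom (2 * n) (int n - int k - 1))) *
              q ^ (k * (k + 1)) *
              (\<Sum>i=-int k..int k. y powi i * q powi (- (i\<^sup>2))))"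
  using sum_sym_shift_eq_conn_sum[OF assms, of n 0]
  by (simp add: cont_frac_lam_nth sym_shift_0_eq_binom theta_def conn_sum_def)

theorem theorem0p1:
  fixes y q :: "'a::field poly poly fract" and n :: nat
  assumes "y = indet_y" and "q = indet_q"
  shows "fps_nth (cont_frac (lam y q)) n =
           1 / (1 - q) ^ (2 * n) *
           (\<Sum>k=0..n.
              (of_nat (binom (2 * n) (int n - int k)) - of_nat (binom (2 * n) (int n - int k - 1))) *
              q ^ (k * (k + 1)) *
              (\<Sum>i=-int k..int k. y powi i * q powi (- (i\<^sup>2))))"
proof -
  have "q \<noteq> 0" "y \<noteq> 0"
    by (simp_all add: assms indet_q_def indet_y_def)
  then show ?thesis by (rule cont_frac_lam_nth_eq)
qed

end
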